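(* Let $X\subseteq\mathbb C$ be a set with a marked point $a\in X$ (with the usual metric). Suppose that all pretangent spaces to $X$ at the point $a$ lie in tangent spaces and that there is a closed cone $B\subseteq\mathbb C$ with a vertex $b$ such that for every tangent space $\Omega_{a,\tilde r}^X$ to $X$ at $a$ there exists an isometry $\psi:\Omega_{a,\tilde r}^X\to B$ with $\psi(\alpha)=b$, where $\alpha=p(\tilde a)$. Then for every ray $l$ with the vertex $a$ we have either $$\lim_{\beta\to0}p(R(X,l,\beta))=0\quad\text{or}\quad\lim_{\beta\to0}p(R(X,l,\beta))=1,$$ where $p(R(X,l,\beta))$ is the right-side porosity of $R(X,l,\beta)$ at the point $0$.
   Context: Pretangent and tangent spaces. Let $(X,d)$ be a metric space with a marked point $a\in X$. A normalizing sequence is a sequence $\tilde r=\{r_n\}_{n\in\mathbb N}$ of positive reals with $r_n\to0$. $\tilde X$ is the set of all sequences of points of $X$. Sequences $\tilde x=\{x_n\},\tilde y=\{y_n\}\in\tilde X$ are mutually stable w.r.t. $\tilde r$ if the finite limit $\tilde d_{\tilde r}(\tilde x,\tilde y)=\tilde d(\tilde x,\tilde y):=\lim_{n\to\infty} d(x_n,y_n)/r_n$ exists. A family $\tilde F\subseteq\tilde X$ is self-stable (w.r.t. $\tilde r$) if every two of its elements are mutually stable; it is maximal self-stable if it is self-stable and every $\tilde z\in\tilde X$ either belongs to $\tilde F$ or is not mutually stable with some $\tilde x\in\tilde F$. Write $\tilde a=(a,a,\dots)$. $\tilde X_{a,\tilde r}$ denotes a maximal self-stable (w.r.t. $\tilde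 r$) family containing $\tilde a$; $\tilde d$ is a pseudometric on it. The metric identification of $(\tilde X_{a,\tilde r},\tilde d)$ (the quotient by $\tilde d(\tilde x,\tilde y)=0$ with the induced metric) is denoted $\Omega_{a,\tilde r}=\Omega^X_{a,\tilde r}$ and called a pretangent space to $X$ at $a$ w.r.t. $\tilde r$ (it depends on the choice of $\tilde X_{a,\tilde r}$); in the expression $\alpha=p(\tilde a)$, $p:\tilde X_{a,\tilde r}\to\Omega_{a,\tilde r}$ is the quotient map. An isometry is a distance-preserving surjection. For a subsequence $\tilde r'=\{r_{n_k}\}_k$ of $\tilde r$ ($n_k$ strictly increasing) and $\tilde x\in\tilde X$ put $\tilde x'=\{x_{n_k}\}_k$. There is a maximal self-stable (w.r.t. $\tilde r'$) family $\tilde X_{a,\tilde r'}\supseteq\{\tilde x':\tilde x\in\tilde X_{a,\tilde r}\}$, and $\tilde x\mapsto\tilde x'$ induces a distance-preserving map $em':\Omega_{a,\tilde r}\to\Omega_{a,\tilde r'}$, where $\Omega_{a,\tilde r'}$ is the metric identification of $\tilde X_{a,\tilde r'}$. The pretangent space $\Omega_{a,\tilde r}$ is tangent if $em'$ is an isometry for every subsequence $\tilde r'$ (this does not depend on the choice of $\tilde X_{a,\tilde r'}$). The pretangent space $\Omega_{a,\tilde r}$ (with corresponding family $\tilde X_{a,\tilde r}$) lies in a tangent space $\Omega_{a,\tilde r'}$ if for some subsequence $\tilde r'$ of $\tilde r$ there is a maximal self-stable (w.r.t. $\tilde r'$) family $\tilde X_{a,\tilde r'}\supseteq\{\tilde x':\tilde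 x\in\tilde X_{a,\tilde r}\}$ whose metric identification $\Omega_{a,\tilde r'}$ is tangent. Rays, cones, sectors, porosity. The ray with vertex $a$ through $b$ is $l_a(b)=\{a+t(b-a):t\in[0,\infty)\}$. A set $A\subseteq\mathbb C$ is a cone with vertex $a$ if $l_a(b)\subseteq A$ for every $b\in A$. For a ray $l$ with vertex $a$ and $\beta>0$, the two-sided angular sector is $\Gamma(a,l,\beta)=\{z\in\mathbb C:\operatorname{dist}(z,l)\le\beta|z-a|\}$, where $\operatorname{dist}(z,l)=\inf_{w\in l}|z-w|$, and $R(X,l,\beta)=\{|z-a|:z\in X\cap\Gamma(a,l,\beta)\}$. For $A\subseteq\mathbb R$ and $x\in A$, the right-side porosity of $A$ at $x$ is $p(A)=\limsup_{h\to0}\frac{l(x,h,A)}{h}$ ($h>0$), where $l(x,h,A)$ is the length of the longest interval in $[x,x+h]\setminus A$. *)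

theory Defs
  imports "HOL-Analysis.Analysis"
begin

section \<open>Pretangent and tangent spaces\<close>

definition normalizing :: "(nat \<Rightarrow> real) \<Rightarrow> bool" where
  "normalizing r \<longleftrightarrow> (\<forall>n. r n > 0) \<and> r \<longlonglongrightarrow> 0"

definition seqs_in :: "'a set \<Rightarrow> (nat \<Rightarrow> 'a) set" where
  "seqs_in X = {x. \<forall>n. x n \<in> X}"

definition mutually_stable ::
    "(nat \<Rightarrow> real) \<Rightarrow> (nat \<Rightarrow> 'a::metric_space) \<Rightarrow> (nat \<Rightarrow> 'a) \<Rightarrow> bool" where
  "mutually_stable r x y \<longleftrightarrow> convergent (\<lambda>n. dist (x n) (y n) / r n)"

text \<open>Only meaningful for mutually stable \<open>x\<close> and \<open>y\<close>.\<close>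

definition dtilde ::
    "(nat \<Rightarrow> real) \<Rightarrow> (nat \<Rightarrow> 'a::metric_space) \<Rightarrow> (nat \<Rightarrow> 'a) \<Rightarrow> real" where
  "dtilde r x y = lim (\<lambda>n. dist (x n) (y n) / r n)"

definition self_stable ::
    "'a::metric_space set \<Rightarrow> (nat \<Rightarrow> real) \<Rightarrow> (nat \<Rightarrow> 'a) set \<Rightarrow> bool" where
  "self_stable X r F \<longleftrightarrow>
     F \<subseteq> seqs_in X \<and> (\<forall>x\<in>F. \<forall>y\<in>F. mutually_stable r x y)"

definition maximal_self_stable ::
    "'a::metric_space set \<Rightarrow> (nat \<Rightarrow> real) \<Rightarrow> (nat \<Rightarrow> 'a) set \<Rightarrow> bool" where
  "maximal_self_stable X r F \<longleftrightarrow>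
     self_stable X r F \<and>
     (\<forall>z\<in>seqs_in X. z \<in> F \<or> (\<exists>x\<in>F. \<not> mutually_stable r z x))"

text \<open>
  A pretangent space depends on the choice of the maximal self-stable family. It is represented
  throughout by the pair of the normalizing sequence \<open>r\<close> and the family \<open>F\<close>; its points and its
  metric are \<open>pt_space r F\<close> and \<open>pt_dist r\<close> below.
\<close>

definition pretangent ::
    "'a::metric_space set \<Rightarrow> 'a \<Rightarrow> (nat \<Rightarrow> real) \<Rightarrow> (nat \<Rightarrow> 'a) set \<Rightarrow> bool" where
  "pretangent X a r F \<longleftrightarrow>
     normalizing r \<and> maximal_self_stable X r F \<and> (\<lambda>_. a) \<in> F"

definition pt_rel ::
    "(nat \<Rightarrow> real) \<Rightarrow> (nat \<Rightarrow> 'a::metric_space) set \<Rightarrow> ((nat \<Rightarrow> 'a) \<times> (nat \<Rightarrow> 'a)) set" where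
  "pt_rel r F = {(x, y). x \<in> F \<and> y \<in> F \<and> dtilde r x y = 0}"

definition pt_space ::
    "(nat \<Rightarrow> real) \<Rightarrow> (nat \<Rightarrow> 'a::metric_space) set \<Rightarrow> (nat \<Rightarrow> 'a) set set" where
  "pt_space r F = F // pt_rel r F"

definition pt_proj ::
    "(nat \<Rightarrow> real) \<Rightarrow> (nat \<Rightarrow> 'a::metric_space) set \<Rightarrow> (nat \<Rightarrow> 'a) \<Rightarrow> (nat \<Rightarrow> 'a) set" where
  "pt_proj r F x = pt_rel r F `` {x}"

definition pt_dist ::
    "(nat \<Rightarrow> real) \<Rightarrow> (nat \<Rightarrow> 'a::metric_space) set \<Rightarrow> (nat \<Rightarrow> 'a) set \<Rightarrow> real" where
  "pt_dist r C D = dtilde r (SOME x. x \<in> C) (SOME y. y \<in> D)"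

definition isometry_betw ::
    "('p \<Rightarrow> 'q) \<Rightarrow> 'p set \<Rightarrow> ('p \<Rightarrow> 'p \<Rightarrow> real) \<Rightarrow> 'q set \<Rightarrow> ('q \<Rightarrow> 'q \<Rightarrow> real) \<Rightarrow> bool" where
  "isometry_betw f M d N e \<longleftrightarrow>
     f ` M = N \<and> (\<forall>x\<in>M. \<forall>y\<in>M. e (f x) (f y) = d x y)"

text \<open>
  The union in \<open>em\<close> ranges over the representatives \<open>x\<close> of the class \<open>C\<close>; all of them give the same
  class of \<open>x \<circ> k\<close> (lemma \<open>em_pt_proj\<close>).
\<close>

definition em ::
    "(nat \<Rightarrow> real) \<Rightarrow> (nat \<Rightarrow> 'a::metric_space) set \<Rightarrow> (nat \<Rightarrow> nat) \<Rightarrow>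
     (nat \<Rightarrow> 'a) set \<Rightarrow> (nat \<Rightarrow> 'a) set" where
  "em r F' k C = (\<Union>x\<in>C. pt_proj (r \<circ> k) F' (x \<circ> k))"

definition extends_along ::
    "'a::metric_space set \<Rightarrow> (nat \<Rightarrow> real) \<Rightarrow> (nat \<Rightarrow> 'a) set \<Rightarrow> (nat \<Rightarrow> nat) \<Rightarrow>
     (nat \<Rightarrow> 'a) set \<Rightarrow> bool" where
  "extends_along X r F k F' \<longleftrightarrow>
     maximal_self_stable X (r \<circ> k) F' \<and> (\<lambda>x. x \<circ> k) ` F \<subseteq> F'"

definition tangent ::
    "'a::metric_space set \<Rightarrow> 'a \<Rightarrow> (nat \<Rightarrow> real) \<Rightarrow> (nat \<Rightarrow> 'a) set \<Rightarrow> bool" where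
  "tangent X a r F \<longleftrightarrow>
     pretangent X a r F \<and>
     (\<forall>k F'. strict_mono k \<longrightarrow> extends_along X r F k F' \<longrightarrow>
        isometry_betw (em r F' k)
          (pt_space r F) (pt_dist r) (pt_space (r \<circ> k) F') (pt_dist (r \<circ> k)))"

definition lies_in_tangent ::
    "'a::metric_space set \<Rightarrow> 'a \<Rightarrow> (nat \<Rightarrow> real) \<Rightarrow> (nat \<Rightarrow> 'a) set \<Rightarrow> bool" where
  "lies_in_tangent X a r F \<longleftrightarrow>
     (\<exists>k F'. strict_mono k \<and> extends_along X r F k F' \<and> tangent X a (r \<circ> k) F')"


section \<open>Rays, cones, sectors, porosity\<close>

text \<open>The degenerate ray \<open>ray a a = {a}\<close> is not excluded.\<close>

definition ray :: "complex \<Rightarrow> complex \<Rightarrow> complex set" where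
  "ray a b = {a + of_real t * (b - a) | t. 0 \<le> t}"

definition cone_with_vertex :: "complex \<Rightarrow> complex set \<Rightarrow> bool" where
  "cone_with_vertex a A \<longleftrightarrow> (\<forall>b\<in>A. ray a b \<subseteq> A)"

definition sector :: "complex \<Rightarrow> complex set \<Rightarrow> real \<Rightarrow> complex set" where
  "sector a l \<beta> = {z. infdist z l \<le> \<beta> * cmod (z - a)}"

definition radii :: "complex set \<Rightarrow> complex \<Rightarrow> complex set \<Rightarrow> real \<Rightarrow> real set" where
  "radii X a l \<beta> = {cmod (z - a) | z. z \<in> X \<inter> sector a l \<beta>}"

definition longest_gap :: "real \<Rightarrow> real \<Rightarrow> real set \<Rightarrow> real" where
  "longest_gap x h A = Sup {measure lborel I | I. is_interval I \<and> I \<subseteq> {x..x + h} - A}"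

text \<open>
  The upper limit is taken in the extended reals because \<open>Limsup\<close> needs a complete lattice; the
  quotients, and hence the porosity, lie in \<open>[0, 1]\<close>.
\<close>

definition right_porosity :: "real set \<Rightarrow> real \<Rightarrow> ereal" where
  "right_porosity A x = Limsup (at_right 0) (\<lambda>h. ereal (longest_gap x h A / h))"


section \<open>The quotient is a metric space and \<open>em\<close> is well defined\<close>

lemma dtilde_tendsto:
  assumes "self_stable X r F" "x \<in> F" "y \<in> F"
  shows "(\<lambda>n. dist (x n) (y n) / r n) \<longlonglongrightarrow> dtilde r x y"
  using assms unfolding self_stable_def mutually_stable_def dtilde_def
  by (simp add: convergent_LIMSEQ_iff)

lemma dtilde_commute: "dtilde r x y = dtilde r y x"
  by (simp add: dtilde_def dist_commute)

lemma dtilde_refl: "dtilde r x x = 0"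
  by (simp add: dtilde_def limI)

lemma dtilde_nonneg:
  assumes "normalizing r" "self_stable X r F" "x \<in> F" "y \<in> F"
  shows "dtilde r x y \<ge> 0"
  using assms(1)
  by (intro LIMSEQ_le_const[OF dtilde_tendsto[OF assms(2-4)]])
     (auto simp: normalizing_def less_imp_le)

lemma dtilde_triangle:
  assumes r: "normalizing r" and F: "self_stable X r F" and "x \<in> F" "y \<in> F" "z \<in> F"
  shows "dtilde r x z \<le> dtilde r x y + dtilde r y z"
proof (rule LIMSEQ_le)
  show "(\<lambda>n. dist (x n) (z n) / r n) \<longlonglongrightarrow> dtilde r x z"
    using assms by (intro dtilde_tendsto)
  show "(\<lambda>n. dist (x n) (y n) / r n + dist (y n) (z n) / r n) \<longlonglongrightarrow> dtilde r x y + dtilde r y z"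
    using assms by (intro tendsto_add dtilde_tendsto)
  have "dist (x n) (z n) / r n \<le> dist (x n) (y n) / r n + dist (y n) (z n) / r n" for n
    using r by (auto simp: normalizing_def add_divide_distrib[symmetric] less_imp_le
        intro!: divide_right_mono dist_triangle)
  then show "\<exists>N. \<forall>n\<ge>N. dist (x n) (z n) / r n \<le> dist (x n) (y n) / r n + dist (y n) (z n) / r n"
    by blast
qed

lemma equiv_pt_rel:
  assumes "normalizing r" "self_stable X r F"
  shows "equiv F (pt_rel r F)"
proof (rule equivI)
  show "pt_rel r F \<subseteq> F \<times> F"
    by (auto simp: pt_rel_def)
  show "refl_on F (pt_rel r F)"
    by (auto simp: refl_on_def pt_rel_def dtilde_refl)
  show "sym (pt_rel r F)"
    by (auto simp: sym_def pt_rel_def dtilde_commute)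
  show "trans (pt_rel r F)"
  proof (rule transI)
    fix x y z assume "(x, y) \<in> pt_rel r F" "(y, z) \<in> pt_rel r F"
    then show "(x, z) \<in> pt_rel r F"
      using dtilde_triangle[OF assms, of x y z] dtilde_nonneg[OF assms, of x z]
      by (auto simp: pt_rel_def)
  qed
qed

lemma pt_dist_proj:
  assumes "normalizing r" "self_stable X r F" "x \<in> F" "y \<in> F"
  shows "pt_dist r (pt_proj r F x) (pt_proj r F y) = dtilde r x y"
proof -
  define u where "u = (SOME u. u \<in> pt_proj r F x)"
  define v where "v = (SOME v. v \<in> pt_proj r F y)"
  have "x \<in> pt_proj r F x" "y \<in> pt_proj r F y"
    using assms by (auto simp: pt_proj_def pt_rel_def dtilde_refl)
  then have "u \<in> pt_proj r F x" "v \<in> pt_proj r F y"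
    unfolding u_def v_def by (metis someI)+
  then have *: "u \<in> F" "v \<in> F" "dtilde r x u = 0" "dtilde r y v = 0"
    by (auto simp: pt_proj_def pt_rel_def)
  have "dtilde r u v = dtilde r x y"
    using dtilde_triangle[OF assms(1,2), of u x v] dtilde_triangle[OF assms(1,2), of x y v]
      dtilde_triangle[OF assms(1,2), of x u y] dtilde_triangle[OF assms(1,2), of u v y]
      * assms(3,4) dtilde_commute[of r u x] dtilde_commute[of r v y]
    by linarith
  then show ?thesis
    by (simp add: pt_dist_def u_def v_def)
qed

lemma pt_space_eq: "pt_space r F = pt_proj r F ` F"
  by (auto simp: pt_space_def pt_proj_def quotient_def)

lemma pt_proj_eq_iff:
  assumes "normalizing r" "self_stable X r F" "x \<in> F" "y \<in> F"
  shows "pt_proj r F x = pt_proj r F y \<longleftrightarrow> dtilde r x y = 0"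
  unfolding pt_proj_def
  using eq_equiv_class_iff[OF equiv_pt_rel[OF assms(1,2)] assms(3,4)] assms(3,4)
  by (simp add: pt_rel_def)

text \<open>
  The restriction to \<open>pt_space r F\<close> is there because \<open>Metric_space\<close> asks for nonnegativity off the
  carrier as well.
\<close>

lemma Metric_space_pt_space:
  assumes "normalizing r" "self_stable X r F"
  shows "Metric_space (pt_space r F)
           (\<lambda>C D. if C \<in> pt_space r F \<and> D \<in> pt_space r F then pt_dist r C D else 0)"
  using dtilde_nonneg[OF assms] dtilde_triangle[OF assms]
  by unfold_locales
     (auto simp: pt_space_eq pt_dist_proj[OF assms] pt_proj_eq_iff[OF assms] dtilde_commute,
      (metis pt_proj_eq_iff[OF assms])+)

lemma em_pt_proj:
  assumes r: "normalizing r" and F: "self_stable X r F" and k: "strict_mono k"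
    and F': "extends_along X r F k F'" and x: "x \<in> F"
  shows "em r F' k (pt_proj r F x) = pt_proj (r \<circ> k) F' (x \<circ> k)"
proof -
  have r': "normalizing (r \<circ> k)"
    using r LIMSEQ_subseq_LIMSEQ[OF _ k] by (auto simp: normalizing_def)
  have F'': "self_stable X (r \<circ> k) F'" and sub: "\<And>y. y \<in> F \<Longrightarrow> y \<circ> k \<in> F'"
    using F' by (auto simp: extends_along_def maximal_self_stable_def)
  have "pt_proj (r \<circ> k) F' (y \<circ> k) = pt_proj (r \<circ> k) F' (x \<circ> k)" if "y \<in> pt_proj r F x" for y
  proof -
    have y: "y \<in> F" "dtilde r y x = 0"
      using that by (auto simp: pt_proj_def pt_rel_def dtilde_commute)
    have "(\<lambda>n. dist ((y \<circ> k) n) ((x \<circ> k) n) / (r \<circ> k) n) \<longlonglongrightarrow> 0"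
      using LIMSEQ_subseq_LIMSEQ[OF dtilde_tendsto[OF F y(1) x] k] y(2) by (simp add: o_def)
    then have "dtilde (r \<circ> k) (y \<circ> k) (x \<circ> k) = 0"
      by (simp add: dtilde_def limI)
    then show ?thesis
      using pt_proj_eq_iff[OF r' F'' sub[OF y(1)] sub[OF x]] by simp
  qed
  moreover have "x \<in> pt_proj r F x"
    using x by (auto simp: pt_proj_def pt_rel_def dtilde_refl)
  ultimately show ?thesis
    unfolding em_def by blast
qed

end

theory Submission
  imports Defs "HOL-Complex_Analysis.Great_Picard"
begin

text \<open>
  The geometric content of the hypothesis is that every blow-up of \<open>X\<close> at \<open>a\<close> is a cone. For a
  normalizing sequence \<open>r\<close>, the rescaled sets \<open>(X - a) / r n\<close> subconverge to a closed set
  \<open>blowup_limit X a r\<close>, in the sense that their distance functions converge pointwise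
  (\<open>exists_blowup_converges_subseq\<close>). When they converge, the sequences in \<open>X\<close> whose rescalings
  converge form a maximal self-stable family, and the corresponding pretangent space is the limit set
  itself. Nothing new appears along a subsequence, so this space is tangent
  (\<open>tangent_blowup_family\<close>). By hypothesis the limit set is then isometric to the cone \<open>B\<close>, the
  origin corresponding to the vertex, and being a cone is a metric property in an inner product space
  (\<open>blowup_limit_cone\<close>).

  Now let \<open>l\<close> be a ray in the direction of the unit vector \<open>e\<close>. The sets of radii shrink with the
  sector, so the porosity can only grow as \<open>\<beta>\<close> decreases to \<open>0\<close>. Suppose that it is positive for some
  \<open>\<beta>0\<close>. Then arbitrarily close to \<open>0\<close> there are gaps of length proportional to their distance from \<open>0\<close>.
  Blowing \<open>X\<close> up along the midpoints of these gaps gives a limit set that avoids \<open>e\<close>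
  (\<open>gap_direction_not_in_blowup_limit\<close>). The limit set is a cone, so it avoids the whole open ray
  through \<open>e\<close>, however close to the origin. By compactness, for each \<open>\<epsilon>\<close> a thin enough sector around
  \<open>l\<close> contains no point of \<open>X\<close> at a distance between \<open>\<epsilon> * r n\<close> and \<open>r n\<close> from \<open>a\<close>, for all large \<open>n\<close>
  (\<open>empty_annuli_near_missed_ray\<close>). The porosity for that sector is thus at least \<open>1 - \<epsilon>\<close>. Hence
  either the porosity vanishes for every \<open>\<beta>\<close>, or it tends to \<open>1\<close>.
\<close>

section \<open>Convergent blow-ups\<close>

text \<open>
  The distance from \<open>q\<close> to the rescaled set \<open>(X - a) / r n\<close>, computed at the original scale.
\<close>

definition blowup_dist :: "'a::real_normed_vector set \<Rightarrow> 'a \<Rightarrow> (nat \<Rightarrow> real) \<Rightarrow> nat \<Rightarrow> 'a \<Rightarrow> real" where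
  "blowup_dist X a r n q = infdist (a + r n *\<^sub>R q) X / r n"

text \<open>
  Pointwise convergence of the distance functions (Wijsman convergence) is Kuratowski convergence of
  the rescaled sets in finite dimension: a point that is a limit along some subsequence is a limit
  along the whole sequence.
\<close>

definition blowup_converges :: "'a::real_normed_vector set \<Rightarrow> 'a \<Rightarrow> (nat \<Rightarrow> real) \<Rightarrow> bool" where
  "blowup_converges X a r \<longleftrightarrow> (\<forall>q. convergent (\<lambda>n. blowup_dist X a r n q))"

definition blowup_limit :: "'a::real_normed_vector set \<Rightarrow> 'a \<Rightarrow> (nat \<Rightarrow> real) \<Rightarrow> 'a set" where
  "blowup_limit X a r = {q. (\<lambda>n. blowup_dist X a r n q) \<longlonglongrightarrow> 0}"

definition blowup_family :: "'a::real_normed_vector set \<Rightarrow> 'a \<Rightarrow> (nat \<Rightarrow> real) \<Rightarrow> (nat \<Rightarrow> 'a) set" where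
  "blowup_family X a r = {x \<in> seqs_in X. convergent (\<lambda>n. (x n - a) /\<^sub>R r n)}"

lemma normalizing_subseq:
  assumes "normalizing r" "strict_mono k"
  shows "normalizing (r \<circ> k)"
  using assms LIMSEQ_subseq_LIMSEQ[OF _ assms(2)] by (auto simp: normalizing_def)

lemma blowup_dist_subseq: "blowup_dist X a (r \<circ> k) n q = blowup_dist X a r (k n) q"
  by (simp add: blowup_dist_def)

lemma blowup_converges_subseq:
  assumes "blowup_converges X a r" "strict_mono k"
  shows "blowup_converges X a (r \<circ> k)"
  unfolding blowup_converges_def
proof
  fix q
  have "convergent ((\<lambda>n. blowup_dist X a r n q) \<circ> k)"
    using assms by (intro convergent_subseq_convergent) (auto simp: blowup_converges_def)
  then show "convergent (\<lambda>n. blowup_dist X a (r \<circ> k) n q)"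
    by (simp only: blowup_dist_subseq) (simp add: o_def)
qed

lemma blowup_dist_nonneg: "0 < r n \<Longrightarrow> 0 \<le> blowup_dist X a r n q"
  by (simp add: blowup_dist_def infdist_nonneg)

lemma blowup_dist_lipschitz:
  assumes "0 < r n"
  shows "\<bar>blowup_dist X a r n p - blowup_dist X a r n q\<bar> \<le> norm (p - q)"
proof -
  have "\<bar>infdist (a + r n *\<^sub>R p) X - infdist (a + r n *\<^sub>R q) X\<bar> \<le> r n * norm (p - q)"
    using infdist_triangle_abs[of "a + r n *\<^sub>R p" X "a + r n *\<^sub>R q"] assms
    by (simp add: dist_norm flip: scaleR_diff_right)
  then show ?thesis
    using assms by (simp add: blowup_dist_def flip: diff_divide_distrib) (simp add: field_simps)
qed

lemma blowup_dist_le: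
  assumes "x \<in> X" "0 < r n"
  shows "blowup_dist X a r n q \<le> norm ((x - a) /\<^sub>R r n - q)"
proof -
  have "a + r n *\<^sub>R q - x = r n *\<^sub>R (q - (x - a) /\<^sub>R r n)"
    using assms by (simp add: algebra_simps)
  then have "dist (a + r n *\<^sub>R q) x = r n * norm ((x - a) /\<^sub>R r n - q)"
    using assms by (simp add: dist_norm norm_minus_commute)
  then show ?thesis
    using infdist_le[OF assms(1), of "a + r n *\<^sub>R q"] assms(2)
    by (simp add: blowup_dist_def field_simps)
qed

lemma blowup_dist_le_norm:
  assumes "a \<in> X" "0 < r n"
  shows "blowup_dist X a r n q \<le> norm q"
  using blowup_dist_le[of a X r n a q] assms by simp

text \<open>
  A diagonal argument gives convergence on a countable dense set; the distance functions are
  1-Lipschitz, which carries it over to every point.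
\<close>

lemma exists_blowup_converges_subseq:
  fixes X :: "'a::euclidean_space set"
  assumes "a \<in> X" "normalizing r"
  obtains k where "strict_mono k" "blowup_converges X a (r \<circ> k)"
proof -
  have pos: "0 < r n" for n
    using assms by (simp add: normalizing_def)
  obtain D :: "'a set" where D: "countable D" "\<And>U. open U \<Longrightarrow> U \<noteq> {} \<Longrightarrow> \<exists>d\<in>D. d \<in> U"
    using countable_dense_exists[where 'a='a] by blast
  \<comment> \<open>The diagonal argument wants one bound for all \<open>q\<close>; the distance itself is only at most \<open>norm q\<close>.\<close>
  define f where "f n q = blowup_dist X a r n q / (1 + norm q)" for n q
  have bound: "norm (f n q) \<le> 1" for n q
  proof -
    have "0 \<le> blowup_dist X a r n q" "blowup_dist X a r n q \<le> norm q"
      using assms(1) pos by (simp_all add: blowup_dist_nonneg blowup_dist_le_norm)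
    then show ?thesis
      by (simp add: f_def abs_of_nonneg divide_le_eq)
  qed
  obtain k where k: "strict_mono k" "\<And>q. q \<in> D \<Longrightarrow> \<exists>l. (\<lambda>n. f (k n) q) \<longlonglongrightarrow> l"
    using function_convergent_subsequence[OF D(1), of f 1] bound by metis
  have "Cauchy (\<lambda>n. blowup_dist X a r (k n) q)" for q
  proof (rule metric_CauchyI)
    fix e :: real assume "0 < e"
    then obtain d where d: "d \<in> D" "norm (q - d) < e / 4"
      using D(2)[of "ball q (e / 4)"] by (auto simp: dist_norm)
    obtain l where "(\<lambda>n. f (k n) d) \<longlonglongrightarrow> l"
      using k(2) d(1) by blast
    then have "(\<lambda>n. f (k n) d * (1 + norm d)) \<longlonglongrightarrow> l * (1 + norm d)"
      by (intro tendsto_intros)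
    moreover have "f (k n) d * (1 + norm d) = blowup_dist X a r (k n) d" for n
      using norm_ge_zero[of d] by (simp add: f_def add_nonneg_eq_0_iff)
    ultimately have "Cauchy (\<lambda>n. blowup_dist X a r (k n) d)"
      by (auto intro: LIMSEQ_imp_Cauchy)
    then obtain N where N: "\<And>m n. m \<ge> N \<Longrightarrow> n \<ge> N \<Longrightarrow>
        dist (blowup_dist X a r (k m) d) (blowup_dist X a r (k n) d) < e / 4"
      using \<open>0 < e\<close> unfolding Cauchy_def by (meson divide_pos_pos zero_less_numeral)
    have "dist (blowup_dist X a r (k m) q) (blowup_dist X a r (k n) q) < e"
      if "m \<ge> N" "n \<ge> N" for m n
      using N[OF that] d(2) blowup_dist_lipschitz[of r "k m" X a q d, OF pos]
        blowup_dist_lipschitz[of r "k n" X a q d, OF pos]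
      unfolding dist_real_def by linarith
    then show "\<exists>M. \<forall>m\<ge>M. \<forall>n\<ge>M. dist (blowup_dist X a r (k m) q) (blowup_dist X a r (k n) q) < e"
      by blast
  qed
  then have "blowup_converges X a (r \<circ> k)"
    by (simp add: blowup_converges_def blowup_dist_subseq Cauchy_convergent_iff)
  with k(1) show thesis
    by (rule that)
qed

text \<open>
  A limit of rescaled points along some of the scales only already makes the distances to \<open>p\<close> tend to
  \<open>0\<close> along all of them, since the full sequence of distances converges.
\<close>

lemma blowup_cluster_point:
  assumes r: "normalizing r" and conv: "blowup_converges X a r"
    and n: "filterlim n at_top sequentially"
    and x: "\<And>j. x j \<in> X" and lim: "(\<lambda>j. (x j - a) /\<^sub>R r (n j)) \<longlonglongrightarrow> p"
  shows "p \<in> blowup_limit X a r"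
proof -
  have pos: "0 < r n" for n
    using r by (simp add: normalizing_def)
  obtain u where u: "(\<lambda>n. blowup_dist X a r n p) \<longlonglongrightarrow> u"
    using conv unfolding blowup_converges_def convergent_def by blast
  have "(\<lambda>j. norm ((x j - a) /\<^sub>R r (n j) - p)) \<longlonglongrightarrow> 0"
    using lim LIM_zero tendsto_norm_zero by blast
  then have "(\<lambda>j. blowup_dist X a r (n j) p) \<longlonglongrightarrow> 0"
    by (rule Lim_null_comparison[rotated])
       (auto simp: blowup_dist_nonneg pos blowup_dist_le x)
  moreover have "(\<lambda>j. blowup_dist X a r (n j) p) \<longlonglongrightarrow> u"
    by (rule filterlim_compose[OF u n])
  ultimately show ?thesis
    using u LIMSEQ_unique by (auto simp: blowup_limit_def)
qed

lemma blowup_limit_approx: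
  assumes r: "normalizing r" and "X \<noteq> {}" and e: "e \<in> blowup_limit X a r"
  obtains x where "x \<in> blowup_family X a r" "(\<lambda>n. (x n - a) /\<^sub>R r n) \<longlonglongrightarrow> e"
proof -
  have pos: "0 < r n" for n
    using r by (simp add: normalizing_def)
  \<comment> \<open>The infimum need not be attained, as \<open>X\<close> need not be closed; the slack is small compared with \<open>r n\<close>.\<close>
  have "\<exists>x\<in>X. dist (a + r n *\<^sub>R e) x < infdist (a + r n *\<^sub>R e) X + r n / Suc n" for n
  proof -
    have "(INF x\<in>X. dist (a + r n *\<^sub>R e) x) < infdist (a + r n *\<^sub>R e) X + r n / Suc n"
      using pos[of n] \<open>X \<noteq> {}\<close> by (simp add: infdist_notempty)
    then show ?thesis
      using \<open>X \<noteq> {}\<close> by (subst (asm) cINF_less_iff) auto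
  qed
  then obtain x where x: "\<And>n. x n \<in> X"
      "\<And>n. dist (a + r n *\<^sub>R e) (x n) < infdist (a + r n *\<^sub>R e) X + r n / Suc n"
    by metis
  have le: "norm ((x n - a) /\<^sub>R r n - e) \<le> blowup_dist X a r n e + inverse (real (Suc n))" for n
  proof -
    have "a + r n *\<^sub>R e - x n = r n *\<^sub>R (e - (x n - a) /\<^sub>R r n)"
      using pos[of n] by (simp add: algebra_simps)
    then have "r n * norm ((x n - a) /\<^sub>R r n - e) < infdist (a + r n *\<^sub>R e) X + r n / Suc n"
      using x(2)[of n] pos[of n] by (simp add: dist_norm norm_minus_commute)
    also have "\<dots> = r n * (blowup_dist X a r n e + inverse (real (Suc n)))"
      using pos[of n] by (simp add: blowup_dist_def distrib_left divide_inverse)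
    finally show ?thesis
      using pos[of n] by simp
  qed
  have "(\<lambda>n. blowup_dist X a r n e + inverse (real (Suc n))) \<longlonglongrightarrow> 0"
    using e LIMSEQ_inverse_real_of_nat by (intro tendsto_add_zero) (auto simp: blowup_limit_def)
  then have "(\<lambda>n. (x n - a) /\<^sub>R r n - e) \<longlonglongrightarrow> 0"
    by (rule Lim_null_comparison[rotated]) (use le in auto)
  then have "(\<lambda>n. (x n - a) /\<^sub>R r n) \<longlonglongrightarrow> e"
    by (rule LIM_zero_cancel)
  with x(1) show thesis
    by (intro that) (auto simp: seqs_in_def blowup_family_def convergent_def)
qed

section \<open>The blow-up limit as a tangent space\<close>

lemma norm_blowup_diff:
  assumes "0 < r n"
  shows "norm ((x n - a) /\<^sub>R r n - (y n - a) /\<^sub>R r n) = dist (x n) (y n) / r n"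
proof -
  have "(x n - a) /\<^sub>R r n - (y n - a) /\<^sub>R r n = (x n - y n) /\<^sub>R r n"
    by (simp flip: scaleR_diff_right)
  then show ?thesis
    using assms by (simp add: dist_norm divide_inverse mult.commute)
qed

lemma blowup_dtilde_tendsto:
  fixes a :: "'a::real_normed_vector"
  assumes "normalizing r" "(\<lambda>n. (x n - a) /\<^sub>R r n) \<longlonglongrightarrow> p" "(\<lambda>n. (y n - a) /\<^sub>R r n) \<longlonglongrightarrow> q"
  shows "(\<lambda>n. dist (x n) (y n) / r n) \<longlonglongrightarrow> dist p q"
proof -
  have "(\<lambda>n. norm ((x n - a) /\<^sub>R r n - (y n - a) /\<^sub>R r n)) \<longlonglongrightarrow> norm (p - q)"
    using assms by (intro tendsto_intros)
  then show ?thesis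
    using assms(1) by (simp add: norm_blowup_diff normalizing_def dist_norm)
qed

text \<open>
  The heart of maximality. Convergence of the distances to the points of the limit set does not fix a
  position in space in general, but any cluster point \<open>p\<close> of the rescaled sequence lies in the limit
  set itself, so the distance to \<open>p\<close> converges too, and then to \<open>0\<close>.
\<close>

lemma stable_imp_blowup_convergent:
  fixes X :: "'a::euclidean_space set"
  assumes r: "normalizing r" and conv: "blowup_converges X a r" and "a \<in> X"
    and z: "z \<in> seqs_in X"
    and stable: "\<And>e. e \<in> blowup_limit X a r \<Longrightarrow> convergent (\<lambda>n. dist ((z n - a) /\<^sub>R r n) e)"
  obtains p where "p \<in> blowup_limit X a r" "(\<lambda>n. (z n - a) /\<^sub>R r n) \<longlonglongrightarrow> p"
proof -
  define w where "w n = (z n - a) /\<^sub>R r n" for n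
  have "0 \<in> blowup_limit X a r"
    using \<open>a \<in> X\<close> by (simp add: blowup_limit_def blowup_dist_def)
  then have "Bseq (\<lambda>n. norm (w n))"
    using stable[of 0] by (auto simp: w_def intro: convergent_imp_Bseq)
  then have "bounded (range w)"
    by (simp add: Bseq_eq_bounded bounded_iff)
  then obtain p m where m: "strict_mono m" "(w \<circ> m) \<longlonglongrightarrow> p"
    using bounded_imp_convergent_subsequence[of w] by blast
  have p: "p \<in> blowup_limit X a r"
    using z m(2) filterlim_subseq[OF m(1)]
    by (intro blowup_cluster_point[OF r conv, of m "z \<circ> m"]) (auto simp: w_def o_def seqs_in_def)
  obtain l where l: "(\<lambda>n. dist (w n) p) \<longlonglongrightarrow> l"
    using stable[OF p] by (auto simp: w_def convergent_def)
  have "(\<lambda>n. dist (w (m n)) p) \<longlonglongrightarrow> 0"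
    using m(2) tendsto_dist_iff[of "w \<circ> m" p] by (simp add: o_def)
  moreover have "(\<lambda>n. dist (w (m n)) p) \<longlonglongrightarrow> l"
    using LIMSEQ_subseq_LIMSEQ[OF l m(1)] by (simp add: o_def)
  ultimately have "l = 0"
    using LIMSEQ_unique by blast
  with l have "w \<longlonglongrightarrow> p"
    using tendsto_dist_iff[of w p] by simp
  with p show thesis
    by (intro that) (simp_all add: w_def[abs_def])
qed

text \<open>
  The subsequence serves two purposes: \<open>k = id\<close> gives maximality of the family, and a general \<open>k\<close>
  shows that every sequence stable along \<open>k\<close> with the restricted family is at distance \<open>0\<close> from a
  restricted member of it.
\<close>

lemma stable_with_blowup_family:
  fixes X :: "'a::euclidean_space set"
  assumes r: "normalizing r" and conv: "blowup_converges X a r" and a: "a \<in> X"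
    and k: "strict_mono k" and z: "z \<in> seqs_in X"
    and stable: "\<And>x. x \<in> blowup_family X a r \<Longrightarrow> mutually_stable (r \<circ> k) z (x \<circ> k)"
  obtains x p where "x \<in> blowup_family X a r" "(\<lambda>n. (x n - a) /\<^sub>R r n) \<longlonglongrightarrow> p"
    "(\<lambda>n. (z n - a) /\<^sub>R (r \<circ> k) n) \<longlonglongrightarrow> p"
proof -
  note r' = normalizing_subseq[OF r k]
  have ne: "X \<noteq> {}"
    using a by blast
  have limit_subset: "blowup_limit X a (r \<circ> k) \<subseteq> blowup_limit X a r"
  proof
    fix e assume e: "e \<in> blowup_limit X a (r \<circ> k)"
    obtain x where "x \<in> blowup_family X a (r \<circ> k)" "(\<lambda>n. (x n - a) /\<^sub>R (r \<circ> k) n) \<longlonglongrightarrow> e"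
      using blowup_limit_approx[OF r' ne e] by metis
    then show "e \<in> blowup_limit X a r"
      by (intro blowup_cluster_point[OF r conv filterlim_subseq[OF k], of x])
         (simp_all add: blowup_family_def seqs_in_def)
  qed
  have approx: "\<exists>x\<in>blowup_family X a r. (\<lambda>n. (x n - a) /\<^sub>R r n) \<longlonglongrightarrow> e"
    if "e \<in> blowup_limit X a (r \<circ> k)" for e
    using blowup_limit_approx[OF r ne] that limit_subset by (metis subsetD)
  have "convergent (\<lambda>n. dist ((z n - a) /\<^sub>R (r \<circ> k) n) e)" if e: "e \<in> blowup_limit X a (r \<circ> k)" for e
  proof -
    obtain x where x: "x \<in> blowup_family X a r" "(\<lambda>n. (x n - a) /\<^sub>R r n) \<longlonglongrightarrow> e"
      using approx[OF e] by blast
    define v where "v n = ((x \<circ> k) n - a) /\<^sub>R (r \<circ> k) n" for n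
    have v: "v \<longlonglongrightarrow> e"
      using LIMSEQ_subseq_LIMSEQ[OF x(2) k] by (simp add: v_def[abs_def] o_def)
    obtain l where "(\<lambda>n. dist (z n) ((x \<circ> k) n) / (r \<circ> k) n) \<longlonglongrightarrow> l"
      using stable[OF x(1)] by (auto simp: mutually_stable_def convergent_def)
    then have "(\<lambda>n. dist ((z n - a) /\<^sub>R (r \<circ> k) n) (v n)) \<longlonglongrightarrow> l"
      using r' unfolding v_def dist_norm
      by (subst norm_blowup_diff) (auto simp: normalizing_def dist_norm)
    moreover have "(\<lambda>n. dist ((z n - a) /\<^sub>R (r \<circ> k) n) e - dist ((z n - a) /\<^sub>R (r \<circ> k) n) (v n)) \<longlonglongrightarrow> 0"
    proof (rule Lim_null_comparison)
      show "(\<lambda>n. dist (v n) e) \<longlonglongrightarrow> 0"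
        using v tendsto_dist_iff[of v e] by simp
      show "\<forall>\<^sub>F n in sequentially. norm (dist ((z n - a) /\<^sub>R (r \<circ> k) n) e
          - dist ((z n - a) /\<^sub>R (r \<circ> k) n) (v n)) \<le> dist (v n) e"
        by (intro always_eventually allI)
           (metis abs_dist_diff_le dist_commute real_norm_def)
    qed
    ultimately show ?thesis
      using tendsto_add by (fastforce simp: convergent_def)
  qed
  then obtain p where "p \<in> blowup_limit X a (r \<circ> k)" "(\<lambda>n. (z n - a) /\<^sub>R (r \<circ> k) n) \<longlonglongrightarrow> p"
    using stable_imp_blowup_convergent[OF r' blowup_converges_subseq[OF conv k] a z] by blast
  with approx that show thesis
    by blast
qed

lemma const_in_blowup_family: "a \<in> X \<Longrightarrow> (\<lambda>_. a) \<in> blowup_family X a r"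
  by (simp add: blowup_family_def seqs_in_def convergent_const)

lemma self_stable_blowup_family:
  assumes "normalizing r"
  shows "self_stable X r (blowup_family X a r)"
proof -
  have "mutually_stable r x y" if xy: "x \<in> blowup_family X a r" "y \<in> blowup_family X a r" for x y
  proof -
    obtain p q where "(\<lambda>n. (x n - a) /\<^sub>R r n) \<longlonglongrightarrow> p" "(\<lambda>n. (y n - a) /\<^sub>R r n) \<longlonglongrightarrow> q"
      using xy unfolding blowup_family_def convergent_def by blast
    then show ?thesis
      using blowup_dtilde_tendsto[OF assms] unfolding mutually_stable_def convergent_def by blast
  qed
  then show ?thesis
    by (auto simp: self_stable_def blowup_family_def)
qed

lemma tangent_blowup_family:
  fixes X :: "'a::euclidean_space set"
  assumes r: "normalizing r" and conv: "blowup_converges X a r" and a: "a \<in> X"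
  shows "tangent X a r (blowup_family X a r)"
proof -
  let ?F = "blowup_family X a r"
  note F = self_stable_blowup_family[OF r, of X a]
  have "z \<in> ?F" if z: "z \<in> seqs_in X" "\<forall>x\<in>?F. mutually_stable r z x" for z
  proof -
    obtain p where "(\<lambda>n. (z n - a) /\<^sub>R (r \<circ> id) n) \<longlonglongrightarrow> p"
      using stable_with_blowup_family[OF r conv a strict_mono_id, of z] z by auto
    with z show ?thesis
      by (auto simp: blowup_family_def convergent_def)
  qed
  with F const_in_blowup_family[OF a] r have "pretangent X a r ?F"
    by (auto simp: pretangent_def maximal_self_stable_def)
  moreover have "isometry_betw (em r F' k) (pt_space r ?F) (pt_dist r) (pt_space (r \<circ> k) F') (pt_dist (r \<circ> k))"
    if k: "strict_mono k" and ext: "extends_along X r ?F k F'" for k F'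
  proof -
    note r' = normalizing_subseq[OF r k]
    have F': "self_stable X (r \<circ> k) F'" and sub: "\<And>y. y \<in> ?F \<Longrightarrow> y \<circ> k \<in> F'"
      using ext by (auto simp: extends_along_def maximal_self_stable_def)
    note em = em_pt_proj[OF r F k ext]
    have "\<exists>x\<in>?F. pt_proj (r \<circ> k) F' z = pt_proj (r \<circ> k) F' (x \<circ> k)" if z: "z \<in> F'" for z
    proof -
      have zX: "z \<in> seqs_in X"
        and stable: "\<And>x. x \<in> ?F \<Longrightarrow> mutually_stable (r \<circ> k) z (x \<circ> k)"
        using z sub F' by (auto simp: self_stable_def)
      obtain x p where x: "x \<in> ?F" "(\<lambda>n. (x n - a) /\<^sub>R r n) \<longlonglongrightarrow> p"
          and zp: "(\<lambda>n. (z n - a) /\<^sub>R (r \<circ> k) n) \<longlonglongrightarrow> p"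
        by (rule stable_with_blowup_family[OF r conv a k zX stable])
      have "(\<lambda>n. ((x \<circ> k) n - a) /\<^sub>R (r \<circ> k) n) \<longlonglongrightarrow> p"
        using LIMSEQ_subseq_LIMSEQ[OF x(2) k] by (simp add: o_def)
      then have "dtilde (r \<circ> k) z (x \<circ> k) = dist p p"
        unfolding dtilde_def by (intro limI blowup_dtilde_tendsto[OF r' zp])
      then have "dtilde (r \<circ> k) z (x \<circ> k) = 0"
        by simp
      with x(1) z sub show ?thesis
        using pt_proj_eq_iff[OF r' F'] by blast
    qed
    then have "(\<lambda>x. pt_proj (r \<circ> k) F' (x \<circ> k)) ` ?F = pt_proj (r \<circ> k) F' ` F'"
      using sub by blast
    then have "em r F' k ` pt_space r ?F = pt_space (r \<circ> k) F'"
      by (simp add: pt_space_eq image_image em cong: image_cong_simp)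
    moreover have "dtilde (r \<circ> k) (x \<circ> k) (y \<circ> k) = dtilde r x y" if "x \<in> ?F" "y \<in> ?F" for x y
      using LIMSEQ_subseq_LIMSEQ[OF dtilde_tendsto[OF F that] k] by (simp add: dtilde_def o_def limI)
    ultimately show ?thesis
      using sub em
      by (simp add: isometry_betw_def) (simp add: pt_space_eq pt_dist_proj[OF r F] pt_dist_proj[OF r' F'])
  qed
  ultimately show ?thesis
    by (auto simp: tangent_def)
qed

text \<open>
  In an inner product space the two distances leave room for one point only (equality in the triangle
  inequality); a distance-preserving map therefore carries rays to rays.
\<close>

lemma scaled_point_unique:
  fixes e e' :: "'a::real_inner"
  assumes "norm e' = t * norm e" "norm (e' - e) = \<bar>t - 1\<bar> * norm e"
  shows "e' = t *\<^sub>R e"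
proof -
  have "(norm e')\<^sup>2 = t\<^sup>2 * (norm e)\<^sup>2" "(norm (e' - e))\<^sup>2 = (t - 1)\<^sup>2 * (norm e)\<^sup>2"
    using assms by (simp_all add: power_mult_distrib)
  then have "inner e' e' = t\<^sup>2 * inner e e"
      "inner (e' - e) (e' - e) = (t - 1)\<^sup>2 * inner e e"
    by (simp_all add: power2_norm_eq_inner)
  then have "inner (e' - t *\<^sub>R e) (e' - t *\<^sub>R e) = 0"
    by (simp add: inner_diff_left inner_diff_right inner_commute algebra_simps power2_eq_square)
  then show ?thesis
    by simp
qed

text \<open>
  The point at parameter \<open>t\<close> on the ray from \<open>b\<close> through the image of \<open>e\<close> lies in \<open>B\<close>. Its preimage in
  the limit set has the distances to the origin and to \<open>e\<close> that characterize \<open>t *\<^sub>R e\<close>.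
\<close>

lemma blowup_limit_cone:
  fixes X B :: "complex set"
  assumes a: "a \<in> X" and r: "normalizing r" and conv: "blowup_converges X a r"
    and cone: "cone_with_vertex b B"
    and iso: "\<forall>r F. tangent X a r F \<longrightarrow>
           (\<exists>\<psi>. isometry_betw \<psi> (pt_space r F) (pt_dist r) B dist \<and>
                \<psi> (pt_proj r F (\<lambda>_. a)) = b)"
    and e: "e \<in> blowup_limit X a r" and t: "0 \<le> t"
  shows "t *\<^sub>R e \<in> blowup_limit X a r"
proof -
  let ?F = "blowup_family X a r"
  note F = self_stable_blowup_family[OF r, of X a] and a' = const_in_blowup_family[OF a, of r]
  obtain \<psi> where \<psi>: "isometry_betw \<psi> (pt_space r ?F) (pt_dist r) B dist"
      "\<psi> (pt_proj r ?F (\<lambda>_. a)) = b"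
    using iso tangent_blowup_family[OF r conv a] by blast
  define \<phi> where "\<phi> x = \<psi> (pt_proj r ?F x)" for x
  have image: "\<phi> ` ?F = B"
    using \<psi>(1) by (simp add: isometry_betw_def pt_space_eq \<phi>_def image_image)
  have dist_\<phi>: "dist (\<phi> x) (\<phi> y) = dist p q"
    if "x \<in> ?F" "y \<in> ?F" "(\<lambda>n. (x n - a) /\<^sub>R r n) \<longlonglongrightarrow> p" "(\<lambda>n. (y n - a) /\<^sub>R r n) \<longlonglongrightarrow> q" for x y p q
  proof -
    have "dist (\<phi> x) (\<phi> y) = dtilde r x y"
      using \<psi>(1) that(1,2) pt_dist_proj[OF r F that(1,2)]
      by (simp add: isometry_betw_def pt_space_eq \<phi>_def)
    then show ?thesis
      using blowup_dtilde_tendsto[OF r that(3,4)] by (simp add: dtilde_def limI)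
  qed
  obtain x where x: "x \<in> ?F" "(\<lambda>n. (x n - a) /\<^sub>R r n) \<longlonglongrightarrow> e"
    using blowup_limit_approx[OF r _ e] a by (metis empty_iff)
  define c where "c = \<phi> x"
  have "b + of_real t * (c - b) \<in> B"
    using cone image x(1) t unfolding cone_with_vertex_def ray_def c_def by blast
  then obtain y where y: "y \<in> ?F" "\<phi> y = b + of_real t * (c - b)"
    using image by (metis imageE)
  then obtain e' where e': "(\<lambda>n. (y n - a) /\<^sub>R r n) \<longlonglongrightarrow> e'"
    by (auto simp: blowup_family_def convergent_def)
  have lim_a: "(\<lambda>n. (a - a) /\<^sub>R r n) \<longlonglongrightarrow> 0"
    by simp
  have "cmod (c - b) = cmod e"
    using dist_\<phi>[OF x(1) a' x(2) lim_a] \<psi>(2) by (simp add: \<phi>_def c_def dist_norm)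
  moreover have "\<phi> y - b = of_real t * (c - b)" "\<phi> y - c = of_real (t - 1) * (c - b)"
    using y(2) by (simp_all add: algebra_simps)
  ultimately have "cmod (\<phi> y - b) = t * cmod e" "cmod (\<phi> y - c) = \<bar>t - 1\<bar> * cmod e"
    using t by (simp_all only: norm_mult norm_of_real abs_of_nonneg)
  then have "cmod e' = t * cmod e" "cmod (e' - e) = \<bar>t - 1\<bar> * cmod e"
    using dist_\<phi>[OF y(1) a' e' lim_a] dist_\<phi>[OF y(1) x(1) e' x(2)] \<psi>(2)
    by (simp_all add: \<phi>_def c_def dist_norm)
  then have "e' = t *\<^sub>R e"
    by (rule scaled_point_unique)
  moreover have "e' \<in> blowup_limit X a r"
    using y(1) e' by (intro blowup_cluster_point[OF r conv filterlim_ident])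
      (auto simp: blowup_family_def seqs_in_def)
  ultimately show ?thesis
    by simp
qed


section \<open>Porosity at the origin\<close>

lemma gap_length_le:
  fixes I :: "real set"
  assumes "0 \<le> h" "I \<subseteq> {x..x + h}"
  shows "measure lborel I \<le> h"
proof (cases "I \<in> sets lborel")
  case True
  then have "measure lborel I \<le> measure lborel {x..x + h}"
    using assms(2) by (intro measure_mono_fmeasurable fmeasurable_compact) auto
  with assms(1) show ?thesis
    by simp
qed (simp add: measure_notin_sets assms)

lemma bdd_above_gap_lengths:
  assumes "0 \<le> h"
  shows "bdd_above {measure lborel I | I. is_interval I \<and> I \<subseteq> {x..x + h} - (A :: real set)}"
  using gap_length_le[OF assms] by (auto intro!: bdd_aboveI[of _ h])

lemma gap_lengths_nonempty:
  "{measure lborel I | I. is_interval I \<and> I \<subseteq> {x..x + h} - (A :: real set)} \<noteq> {}"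
  using is_interval_empty by blast

lemma longest_gap_ge:
  assumes "0 \<le> h" "is_interval I" "I \<subseteq> {x..x + h} - A"
  shows "measure lborel I \<le> longest_gap x h A"
  unfolding longest_gap_def
  using assms by (intro cSup_upper bdd_above_gap_lengths) auto

lemma longest_gap_le:
  assumes "0 \<le> h"
  shows "longest_gap x h A \<le> h"
  unfolding longest_gap_def
proof (rule cSup_least[OF gap_lengths_nonempty])
  show "m \<le> h" if "m \<in> {measure lborel I | I. is_interval I \<and> I \<subseteq> {x..x + h} - A}" for m
    using that gap_length_le[OF assms, of _ x] by blast
qed

lemma longest_gap_nonneg: "0 \<le> h \<Longrightarrow> 0 \<le> longest_gap x h A"
  using longest_gap_ge[of h "{}" x A] by simp

lemma longest_gap_antimono:
  assumes "0 \<le> h" "A \<subseteq> B"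
  shows "longest_gap x h B \<le> longest_gap x h A"
  unfolding longest_gap_def
  using assms by (intro cSup_subset_mono bdd_above_gap_lengths gap_lengths_nonempty) blast+

text \<open>
  A set of reals of diameter at most \<open>c\<close> has measure at most \<open>c\<close>, so an interval of larger measure
  contains two points further apart, and with them the segment that they bound.
\<close>

lemma longest_gap_greaterE:
  assumes "0 \<le> c" "c < longest_gap x h A"
  obtains s t where "c < t - s" "{s..t} \<subseteq> {x..x + h} - A"
proof -
  obtain I where I: "is_interval I" "I \<subseteq> {x..x + h} - A" "c < measure lborel I"
    using less_cSupE[OF assms(2)[unfolded longest_gap_def] gap_lengths_nonempty] by blast
  have "\<exists>s\<in>I. \<exists>t\<in>I. c < t - s"
  proof (rule ccontr)
    assume "\<not> ?thesis"
    then have diam: "t - s \<le> c" if "s \<in> I" "t \<in> I" for s t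
      using that by force
    have "I \<noteq> {}"
      using I(3) assms(1) by auto
    have bdd: "bdd_below I"
      using I(2) by (intro bdd_belowI[of _ x]) auto
    have "I \<subseteq> {Inf I..Inf I + c}"
    proof
      fix t assume t: "t \<in> I"
      have "t - c \<le> Inf I"
        using diam[OF _ t] \<open>I \<noteq> {}\<close> by (intro cInf_greatest) (auto simp: algebra_simps)
      then show "t \<in> {Inf I..Inf I + c}"
        using cInf_lower[OF t bdd] by simp
    qed
    from gap_length_le[OF assms(1) this] I(3) show False
      by simp
  qed
  then obtain s t where st: "s \<in> I" "t \<in> I" "c < t - s"
    by blast
  have "{s..t} \<subseteq> I"
    using mem_is_interval_1_I[OF I(1) st(1,2)] by auto
  with I(2) st(3) show thesis
    by (intro that) auto
qed

lemma eventually_at_right_0_pos: "\<forall>\<^sub>F h in at_right (0::real). 0 < h"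
  by (simp add: eventually_at_right_less)

lemma right_porosity_0_nonneg: "0 \<le> right_porosity A 0"
  unfolding right_porosity_def
  by (rule le_Limsup)
     (auto intro!: eventually_mono[OF eventually_at_right_0_pos] divide_nonneg_pos longest_gap_nonneg)

lemma right_porosity_le_1: "right_porosity A x \<le> 1"
  unfolding right_porosity_def
  by (rule Limsup_bounded)
     (auto intro!: eventually_mono[OF eventually_at_right_0_pos] longest_gap_le simp: divide_le_eq)

lemma right_porosity_antimono:
  assumes "A \<subseteq> B"
  shows "right_porosity B x \<le> right_porosity A x"
  unfolding right_porosity_def
  by (rule Limsup_mono)
     (auto intro!: eventually_mono[OF eventually_at_right_0_pos] divide_right_mono
        longest_gap_antimono assms)

text \<open>
  The porosity is an upper limit, so large gaps along one sequence of scales suffice.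
\<close>

lemma right_porosity_ge:
  assumes r: "normalizing r" and gap: "\<forall>\<^sub>F n in sequentially. c * r n \<le> longest_gap x (r n) A"
  shows "ereal c \<le> right_porosity A x"
proof (rule ccontr)
  assume "\<not> ?thesis"
  then have "\<forall>\<^sub>F h in at_right 0. ereal (longest_gap x h A / h) < ereal c"
    unfolding right_porosity_def by (intro Limsup_lessD) simp
  moreover have "filterlim r (at_right 0) sequentially"
    using r unfolding filterlim_at by (auto simp: normalizing_def less_imp_neq[symmetric])
  ultimately have "\<forall>\<^sub>F n in sequentially. ereal (longest_gap x (r n) A / r n) < ereal c"
    by (rule eventually_compose_filterlim)
  then have "\<forall>\<^sub>F n in sequentially. False"
    using gap by eventually_elim (use r in \<open>auto simp: normalizing_def divide_less_eq not_less\<close>)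
  then show False
    by simp
qed

text \<open>
  The midpoints of the gaps serve as scales. In this way a single rescaling puts every gap around the
  radius \<open>1\<close>, with a relative width bounded from below.
\<close>

lemma right_porosity_pos_imp_centred_gaps:
  assumes "0 < right_porosity A 0"
  obtains r \<delta> where "normalizing r" "0 < \<delta>"
    "\<And>n \<rho>. \<bar>\<rho> - r n\<bar> \<le> \<delta> * r n \<Longrightarrow> \<rho> \<notin> A"
proof -
  obtain c where c: "0 < ereal c" "ereal c < right_porosity A 0"
    using ereal_dense2[OF assms] by blast
  then have "0 < c"
    by simp
  have ex: "\<exists>s t h. h < 1 / Suc n \<and> 0 < h \<and> c * h < t - s \<and> {s..t} \<subseteq> {0..h} - A" for n
  proof -
    have small: "\<forall>\<^sub>F h in at_right 0. h < 1 / real (Suc n) \<and> 0 < h"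
      by (auto simp: eventually_at_right_field intro!: exI[of _ "1 / real (Suc n)"])
    have "\<exists>h. ereal c < ereal (longest_gap 0 h A / h) \<and> h < 1 / real (Suc n) \<and> 0 < h"
    proof (rule ccontr)
      assume "\<not> ?thesis"
      then have "\<forall>\<^sub>F h in at_right 0. ereal (longest_gap 0 h A / h) \<le> ereal c"
        by (intro eventually_mono[OF small]) (meson not_le)
      then have "right_porosity A 0 \<le> ereal c"
        unfolding right_porosity_def by (rule Limsup_bounded)
      with c(2) show False
        by simp
    qed
    then obtain h where h: "ereal c < ereal (longest_gap 0 h A / h)" "h < 1 / real (Suc n)" "0 < h"
      by blast
    then have "0 \<le> c * h" "c * h < longest_gap 0 h A"
      using \<open>0 < c\<close> by (auto simp: less_divide_eq)
    then obtain s t where "c * h < t - s" "{s..t} \<subseteq> {0..h} - A"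
      by (rule longest_gap_greaterE) auto
    with h show ?thesis
      by blast
  qed
  obtain s t h where h: "\<And>n. h n < 1 / Suc n" "\<And>n. 0 < h n" "\<And>n. c * h n < t n - s n"
      "\<And>n. {s n..t n} \<subseteq> {0..h n} - A"
    using ex by metis
  define r where "r n = (s n + t n) / 2" for n
  have st: "0 \<le> s n" "s n < t n" "t n \<le> h n" for n
  proof -
    show "s n < t n"
      using h(3)[of n] mult_pos_pos[OF \<open>0 < c\<close> h(2)[of n]] by linarith
    then have "s n \<in> {s n..t n}" "t n \<in> {s n..t n}"
      by auto
    with h(4)[of n] show "0 \<le> s n" "t n \<le> h n"
      by auto
  qed
  have pos: "0 < r n" and r_le: "r n \<le> 1 / Suc n" and r_le_h: "r n \<le> h n" for n
    using st[of n] h(1)[of n] by (auto simp: r_def)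
  have "r \<longlonglongrightarrow> 0"
    using pos r_le less_imp_le LIMSEQ_Suc[OF lim_1_over_n]
    by (intro tendsto_sandwich[OF _ _ tendsto_const, of 0 r _ "\<lambda>n. 1 / Suc n"] always_eventually) auto
  with pos have "normalizing r"
    by (simp add: normalizing_def)
  \<comment> \<open>Half the gap is longer than \<open>c * h n / 2\<close>, and the midpoint \<open>r n\<close> is at most \<open>h n\<close>.\<close>
  moreover have "\<rho> \<notin> A" if \<rho>: "\<bar>\<rho> - r n\<bar> \<le> c / 2 * r n" for n \<rho>
  proof -
    have "c * r n \<le> c * h n"
      using r_le_h \<open>0 < c\<close> by simp
    then have "2 * \<bar>\<rho> - r n\<bar> \<le> t n - s n"
      using \<rho> h(3)[of n] by simp
    then have "\<rho> \<in> {s n..t n}"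
      by (auto simp: r_def abs_le_iff field_simps)
    with h(4) show ?thesis
      by blast
  qed
  ultimately show thesis
    using that[of r "c / 2"] \<open>0 < c\<close> by simp
qed

section \<open>Porosity of the radii in thin sectors\<close>

lemma radii_mono:
  assumes "\<beta> \<le> \<beta>'"
  shows "radii X a l \<beta> \<subseteq> radii X a l \<beta>'"
proof -
  have "sector a l \<beta> \<subseteq> sector a l \<beta>'"
    unfolding sector_def using assms mult_right_mono[OF assms norm_ge_zero] order_trans by blast
  then show ?thesis
    by (auto simp: radii_def)
qed

text \<open>
  As the porosity is at most \<open>1\<close> and monotone in \<open>\<beta>\<close>, one good \<open>\<beta>\<close> for each \<open>\<epsilon>\<close> is enough.
\<close>

lemma porosity_radii_tendsto_1:
  assumes "\<And>\<epsilon>. 0 < \<epsilon> \<Longrightarrow> \<exists>\<beta>>0. ereal (1 - \<epsilon>) \<le> right_porosity (radii X a l \<beta>) x"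
  shows "((\<lambda>\<beta>. right_porosity (radii X a l \<beta>) x) \<longlongrightarrow> 1) (at_right 0)"
proof (rule order_tendstoI)
  fix c :: ereal assume "1 < c"
  then show "\<forall>\<^sub>F \<beta> in at_right 0. right_porosity (radii X a l \<beta>) x < c"
    by (intro always_eventually allI le_less_trans[OF right_porosity_le_1])
next
  fix c :: ereal assume "c < 1"
  then obtain d where d: "c < ereal d" "ereal d < 1"
    using ereal_dense2 by blast
  then obtain \<beta>0 where \<beta>0: "0 < \<beta>0" "ereal d \<le> right_porosity (radii X a l \<beta>0) x"
    using assms[of "1 - d"] by auto
  have "c < right_porosity (radii X a l \<beta>) x" if "\<beta> < \<beta>0" for \<beta>
    using d(1) \<beta>0(2) right_porosity_antimono[OF radii_mono, of \<beta> \<beta>0 X a l x] that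
    by (meson less_imp_le less_le_trans)
  with \<beta>0(1) show "\<forall>\<^sub>F \<beta> in at_right 0. c < right_porosity (radii X a l \<beta>) x"
    by (auto simp: eventually_at_right_field)
qed

lemma porosity_ge_of_empty_annulus:
  assumes r: "normalizing r" and \<epsilon>: "0 < \<epsilon>"
    and gap: "\<forall>\<^sub>F n in sequentially. \<forall>\<rho>\<in>A. \<epsilon> * r n \<le> \<rho> \<longrightarrow> r n < \<rho>"
  shows "ereal (1 - \<epsilon>) \<le> right_porosity A 0"
proof (rule right_porosity_ge[OF r])
  show "\<forall>\<^sub>F n in sequentially. (1 - \<epsilon>) * r n \<le> longest_gap 0 (r n) A"
    using gap
  proof eventually_elim
    case (elim n)
    have pos: "0 < r n"
      using r by (simp add: normalizing_def)
    have "{\<epsilon> * r n..r n} \<subseteq> {0..0 + r n} - A"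
      using elim pos \<epsilon> by (force intro: order_trans[of 0 "\<epsilon> * r n"])
    then have "measure lborel {\<epsilon> * r n..r n} \<le> longest_gap 0 (r n) A"
      using pos by (intro longest_gap_ge) (auto simp: is_interval_cc)
    moreover have "(1 - \<epsilon>) * r n \<le> measure lborel {\<epsilon> * r n..r n}"
      by (cases "\<epsilon> * r n \<le> r n") (auto simp: algebra_simps)
    ultimately show ?case
      by linarith
  qed
qed

lemma ray_add: "ray a (a + e) = {a + of_real t * e | t. 0 \<le> t}"
  by (simp add: ray_def)

lemma ray_eq_unit_ray:
  assumes "c \<noteq> a"
  shows "ray a c = ray a (a + sgn (c - a))"
proof -
  define d where "d = cmod (c - a)"
  define e where "e = sgn (c - a)"
  have d: "0 < d" and c: "c - a = of_real d * e"
    using assms by (simp_all add: d_def e_def sgn_eq)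
  have "a + of_real t * (c - a) = a + of_real (t * d) * e"
       "a + of_real t * e = a + of_real (t / d) * (c - a)" for t
    using d unfolding c by simp_all
  with d show ?thesis
    unfolding e_def[symmetric] ray_add unfolding ray_def
    by (safe; metis mult_nonneg_nonneg divide_nonneg_pos less_imp_le)
qed

text \<open>
  Points of \<open>X\<close> whose rescalings converge to \<open>e\<close> eventually lie in every sector around the ray, at a
  distance from \<open>a\<close> asymptotic to \<open>r n\<close>, which is in the middle of the gap.
\<close>

lemma gap_direction_not_in_blowup_limit:
  assumes r: "normalizing r" and "X \<noteq> {}" and e: "cmod e = 1" and \<beta>: "0 < \<beta>" and \<delta>: "0 < \<delta>"
    and gap: "\<And>n \<rho>. \<bar>\<rho> - r n\<bar> \<le> \<delta> * r n \<Longrightarrow> \<rho> \<notin> radii X a (ray a (a + e)) \<beta>"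
  shows "e \<notin> blowup_limit X a r"
proof
  assume "e \<in> blowup_limit X a r"
  then obtain x where x: "x \<in> blowup_family X a r" "(\<lambda>n. (x n - a) /\<^sub>R r n) \<longlonglongrightarrow> e"
    using blowup_limit_approx[OF r \<open>X \<noteq> {}\<close>] by metis
  define w where "w n = (x n - a) /\<^sub>R r n" for n
  have w: "w \<longlonglongrightarrow> e"
    using x(2) by (simp add: w_def[abs_def])
  have "(\<lambda>n. \<bar>cmod (w n) - 1\<bar>) \<longlonglongrightarrow> \<bar>cmod e - 1\<bar>"
    by (intro tendsto_intros w)
  then have "\<forall>\<^sub>F n in sequentially. \<bar>cmod (w n) - 1\<bar> < \<delta>"
    using e \<delta> by (intro order_tendstoD) auto
  moreover have "(\<lambda>n. cmod (w n - e) - \<beta> * cmod (w n)) \<longlonglongrightarrow> cmod (e - e) - \<beta> * cmod e"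
    by (intro tendsto_intros w)
  then have "\<forall>\<^sub>F n in sequentially. cmod (w n - e) - \<beta> * cmod (w n) < 0"
    using e \<beta> by (intro order_tendstoD) auto
  ultimately have "\<forall>\<^sub>F n in sequentially. False"
  proof eventually_elim
    case (elim n)
    have pos: "0 < r n"
      using r by (simp add: normalizing_def)
    have xn: "x n = a + of_real (r n) * w n"
      using pos by (simp add: w_def flip: scaleR_conv_of_real)
    have norm_x: "cmod (x n - a) = r n * cmod (w n)"
      using pos by (simp add: xn norm_mult)
    have "a + of_real (r n) * e \<in> ray a (a + e)"
      using pos unfolding ray_add by auto
    then have "infdist (x n) (ray a (a + e)) \<le> dist (x n) (a + of_real (r n) * e)"
      by (rule infdist_le)
    also have "\<dots> = r n * cmod (w n - e)"
      using pos by (simp add: xn dist_norm norm_mult flip: right_diff_distrib)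
    also have "\<dots> \<le> \<beta> * cmod (x n - a)"
      using elim(2) pos by (simp add: norm_x)
    finally have "cmod (x n - a) \<in> radii X a (ray a (a + e)) \<beta>"
      using x(1) by (auto simp: radii_def sector_def blowup_family_def seqs_in_def)
    moreover have "cmod (x n - a) - r n = r n * (cmod (w n) - 1)"
      by (simp add: norm_x algebra_simps)
    then have "\<bar>cmod (x n - a) - r n\<bar> = r n * \<bar>cmod (w n) - 1\<bar>"
      using pos by (simp add: abs_mult)
    then have "\<bar>cmod (x n - a) - r n\<bar> \<le> \<delta> * r n"
      using elim(1) pos by simp
    ultimately show False
      using gap by blast
  qed
  then show False
    by simp
qed

text \<open>
  Otherwise there are points of \<open>X\<close> in ever thinner sectors and in annuli that are, after rescaling,
  \<open>\<epsilon> \<le> \<bar>z\<bar> \<le> 1\<close>. A cluster point of the rescaled points lies in the limit set and on the ray, and it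
  is not the origin.
\<close>

lemma empty_annuli_near_missed_ray:
  assumes r: "normalizing r" and conv: "blowup_converges X a r" and e: "cmod e = 1"
    and miss: "\<And>t. 0 < t \<Longrightarrow> t *\<^sub>R e \<notin> blowup_limit X a r" and \<epsilon>: "0 < \<epsilon>"
  shows "\<exists>\<beta>>0. \<forall>\<^sub>F n in sequentially. \<forall>\<rho>\<in>radii X a (ray a (a + e)) \<beta>. \<epsilon> * r n \<le> \<rho> \<longrightarrow> r n < \<rho>"
proof (rule ccontr)
  assume neg: "\<not> ?thesis"
  have pos: "0 < r n" for n
    using r by (simp add: normalizing_def)
  \<comment> \<open>The factor \<open>2\<close> makes the inequality strict, so that some point of the ray satisfies it.\<close>
  have "\<exists>n x s. j \<le> n \<and> x \<in> X \<and> 0 \<le> s \<and> \<epsilon> * r n \<le> cmod (x - a) \<and> cmod (x - a) \<le> r n \<and>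
      cmod (x - (a + of_real s * e)) < 2 / real (Suc j) * cmod (x - a)" for j
  proof -
    have "\<not> (\<forall>\<^sub>F n in sequentially. \<forall>\<rho>\<in>radii X a (ray a (a + e)) (1 / real (Suc j)).
        \<epsilon> * r n \<le> \<rho> \<longrightarrow> r n < \<rho>)"
      using neg by force
    then obtain n \<rho> where n: "j \<le> n" "\<rho> \<in> radii X a (ray a (a + e)) (1 / real (Suc j))"
        "\<epsilon> * r n \<le> \<rho>" "\<rho> \<le> r n"
      unfolding eventually_sequentially by (meson not_less)
    then obtain x where x: "x \<in> X" "\<rho> = cmod (x - a)"
        "infdist x (ray a (a + e)) \<le> 1 / real (Suc j) * cmod (x - a)"
      by (auto simp: radii_def sector_def)
    have ne: "ray a (a + e) \<noteq> {}"
      unfolding ray_add by auto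
    have "0 < cmod (x - a)"
      using n(3) x(2) mult_pos_pos[OF \<epsilon> pos[of n]] by linarith
    then have "1 / real (Suc j) * cmod (x - a) < 2 / real (Suc j) * cmod (x - a)"
      by (intro mult_strict_right_mono divide_strict_right_mono) auto
    with x(3) have "(INF p\<in>ray a (a + e). dist x p) < 2 / real (Suc j) * cmod (x - a)"
      using ne by (simp add: infdist_notempty)
    then obtain p where "p \<in> ray a (a + e)" "dist x p < 2 / real (Suc j) * cmod (x - a)"
      using ne by (subst (asm) cINF_less_iff) auto
    then obtain s where "0 \<le> s" "cmod (x - (a + of_real s * e)) < 2 / real (Suc j) * cmod (x - a)"
      unfolding ray_add by (auto simp: dist_norm)
    with n x show ?thesis
      by blast
  qed
  then obtain n x s where n: "\<And>j. j \<le> n j" and x: "\<And>j. x j \<in> X" and s: "\<And>j. 0 \<le> s j"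
      and lower: "\<And>j. \<epsilon> * r (n j) \<le> cmod (x j - a)" and upper: "\<And>j. cmod (x j - a) \<le> r (n j)"
      and close: "\<And>j. cmod (x j - (a + of_real (s j) * e)) < 2 / real (Suc j) * cmod (x j - a)"
    by metis
  define w where "w j = (x j - a) /\<^sub>R r (n j)" for j
  define \<sigma> where "\<sigma> j = s j / r (n j)" for j
  have norm_w: "cmod (w j) = cmod (x j - a) / r (n j)" for j
    using pos[of "n j"] by (simp add: w_def divide_inverse mult.commute)
  have w_le: "cmod (w j) \<le> 1" and w_ge: "\<epsilon> \<le> cmod (w j)" for j
    using upper[of j] lower[of j] pos[of "n j"] by (simp_all add: norm_w divide_le_eq le_divide_eq)
  have diff: "cmod (w j - \<sigma> j *\<^sub>R e) \<le> 2 / real (Suc j)" for j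
  proof -
    have "w j - \<sigma> j *\<^sub>R e = (x j - (a + of_real (s j) * e)) /\<^sub>R r (n j)"
      using pos[of "n j"]
      by (simp add: w_def \<sigma>_def scaleR_conv_of_real algebra_simps divide_inverse)
    then have "cmod (w j - \<sigma> j *\<^sub>R e) = cmod (x j - (a + of_real (s j) * e)) / r (n j)"
      using pos[of "n j"] by (simp add: divide_inverse mult.commute)
    also have "\<dots> \<le> 2 / real (Suc j) * cmod (x j - a) / r (n j)"
      using close[of j] pos[of "n j"] by (intro divide_right_mono) auto
    also have "\<dots> = 2 / real (Suc j) * cmod (w j)"
      by (simp add: norm_w)
    also have "\<dots> \<le> 2 / real (Suc j)"
      using w_le[of j] by (intro mult_left_le) auto
    finally show ?thesis .
  qed
  have "bounded (range w)"
    using w_le by (auto simp: bounded_iff)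
  then obtain p m where m: "strict_mono m" "(w \<circ> m) \<longlonglongrightarrow> p"
    using bounded_imp_convergent_subsequence[of w] by blast
  have "filterlim n at_top sequentially"
    using n by (intro filterlim_at_top_mono[OF filterlim_ident]) auto
  then have "filterlim (n \<circ> m) at_top sequentially"
    unfolding o_def using filterlim_subseq[OF m(1)] by (rule filterlim_compose)
  then have p: "p \<in> blowup_limit X a r"
    by (rule blowup_cluster_point[OF r conv, where x = "x \<circ> m"])
       (use x m(2) in \<open>simp_all add: w_def[abs_def] o_def\<close>)
  have "(\<lambda>j. 2 / real (Suc j)) \<longlonglongrightarrow> 0"
    using tendsto_mult_right_zero[OF LIMSEQ_inverse_real_of_nat, of 2] by (simp add: divide_inverse)
  then have "(\<lambda>j. w j - \<sigma> j *\<^sub>R e) \<longlonglongrightarrow> 0"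
    by (rule Lim_null_comparison[rotated]) (use diff in auto)
  then have "(\<lambda>j. w (m j) - \<sigma> (m j) *\<^sub>R e) \<longlonglongrightarrow> 0"
    using LIMSEQ_subseq_LIMSEQ[OF _ m(1)] by (fastforce simp: o_def)
  then have "(\<lambda>j. w (m j) - (w (m j) - \<sigma> (m j) *\<^sub>R e)) \<longlonglongrightarrow> p - 0"
    using m(2) by (intro tendsto_diff) (auto simp: o_def)
  then have \<sigma>p: "(\<lambda>j. \<sigma> (m j) *\<^sub>R e) \<longlonglongrightarrow> p"
    by simp
  have "(\<lambda>j. cmod (\<sigma> (m j) *\<^sub>R e)) \<longlonglongrightarrow> cmod p"
    by (rule tendsto_norm[OF \<sigma>p])
  moreover have "cmod (\<sigma> j *\<^sub>R e) = \<sigma> j" for j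
    using e s[of j] pos[of "n j"] by (simp add: \<sigma>_def)
  ultimately have "(\<lambda>j. \<sigma> (m j)) \<longlonglongrightarrow> cmod p"
    by simp
  then have "(\<lambda>j. \<sigma> (m j) *\<^sub>R e) \<longlonglongrightarrow> cmod p *\<^sub>R e"
    by (intro tendsto_intros)
  with \<sigma>p have "p = cmod p *\<^sub>R e"
    by (rule LIMSEQ_unique)
  moreover have "(\<lambda>j. cmod (w (m j))) \<longlonglongrightarrow> cmod p"
    using tendsto_norm[OF m(2)] by (simp add: o_def)
  then have "\<epsilon> \<le> cmod p"
    by (rule LIMSEQ_le_const) (use w_ge in blast)
  then have "0 < cmod p"
    using \<epsilon> by linarith
  ultimately show False
    using miss[of "cmod p"] p by metis
qed

text \<open>
  For the degenerate ray the sector collapses to the vertex as soon as \<open>\<beta> < 1\<close>, so the porosity is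
  \<open>1\<close> there.
\<close>

lemma radii_degenerate:
  assumes "\<beta> < 1"
  shows "radii X a {a} \<beta> \<subseteq> {0}"
proof -
  have "z = a" if "cmod (z - a) \<le> \<beta> * cmod (z - a)" for z
  proof (rule ccontr)
    assume "z \<noteq> a"
    then have "0 < cmod (z - a)"
      by simp
    with that assms show False
      by simp
  qed
  then show ?thesis
    by (auto simp: radii_def sector_def dist_norm)
qed

section \<open>The dichotomy\<close>

theorem theorem1p10:
  fixes X B :: "complex set" and a b :: complex
  assumes "a \<in> X"
    and "\<forall>r F. pretangent X a r F \<longrightarrow> lies_in_tangent X a r F"
    and "closed B" and "cone_with_vertex b B"
    and "\<forall>r F. tangent X a r F \<longrightarrow>
           (\<exists>\<psi>. isometry_betw \<psi> (pt_space r F) (pt_dist r) B dist \<and>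
                \<psi> (pt_proj r F (\<lambda>_. a)) = b)"
  shows "\<forall>l\<in>range (ray a).
           ((\<lambda>\<beta>. right_porosity (radii X a l \<beta>) 0) \<longlongrightarrow> 0) (at_right 0) \<or>
           ((\<lambda>\<beta>. right_porosity (radii X a l \<beta>) 0) \<longlongrightarrow> 1) (at_right 0)"
proof (intro ballI)
  fix l assume "l \<in> range (ray a)"
  then obtain c where l: "l = ray a c"
    by blast
  consider (degenerate) "c = a"
    | (zero) "\<forall>\<beta>>0. right_porosity (radii X a l \<beta>) 0 = 0"
    | (positive) \<beta>0 where "c \<noteq> a" "0 < \<beta>0" "0 < right_porosity (radii X a l \<beta>0) 0"
    using right_porosity_0_nonneg by (metis order_le_less)
  then show "((\<lambda>\<beta>. right_porosity (radii X a l \<beta>) 0) \<longlongrightarrow> 0) (at_right 0) \<or>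
      ((\<lambda>\<beta>. right_porosity (radii X a l \<beta>) 0) \<longlongrightarrow> 1) (at_right 0)"
  proof cases
    case degenerate
    then have l_eq: "l = {a}"
      unfolding l by (auto simp: ray_def)
    define r :: "nat \<Rightarrow> real" where "r n = inverse (real (Suc n))" for n
    have r: "normalizing r"
      using LIMSEQ_inverse_real_of_nat by (simp add: normalizing_def r_def[abs_def])
    have "((\<lambda>\<beta>. right_porosity (radii X a l \<beta>) 0) \<longlongrightarrow> 1) (at_right 0)"
    proof (rule porosity_radii_tendsto_1)
      fix \<epsilon> :: real assume \<epsilon>: "0 < \<epsilon>"
      have "\<not> \<epsilon> * r n \<le> 0" for n
        using \<epsilon> r by (simp add: normalizing_def not_le)
      then have "ereal (1 - \<epsilon>) \<le> right_porosity (radii X a l (1 / 2)) 0"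
        using radii_degenerate[of "1 / 2" X a] unfolding l_eq
        by (intro porosity_ge_of_empty_annulus[OF r \<epsilon>] always_eventually) force
      then show "\<exists>\<beta>>0. ereal (1 - \<epsilon>) \<le> right_porosity (radii X a l \<beta>) 0"
        by (intro exI[of _ "1 / 2"]) simp
    qed
    then show ?thesis ..
  next
    case zero
    then have "\<forall>\<^sub>F \<beta> in at_right 0. right_porosity (radii X a l \<beta>) 0 = 0"
      by (intro eventually_mono[OF eventually_at_right_0_pos]) auto
    then show ?thesis
      by (intro disjI1 tendsto_eventually)
  next
    case positive
    define e where "e = sgn (c - a)"
    have e: "cmod e = 1" and l_eq: "l = ray a (a + e)"
      using positive(1) ray_eq_unit_ray by (simp_all add: e_def norm_sgn l)
    have ne: "X \<noteq> {}"
      using assms(1) by blast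
    obtain r0 \<delta> where r0: "normalizing r0" and \<delta>: "0 < \<delta>"
        and gap0: "\<And>n \<rho>. \<bar>\<rho> - r0 n\<bar> \<le> \<delta> * r0 n \<Longrightarrow> \<rho> \<notin> radii X a l \<beta>0"
      using right_porosity_pos_imp_centred_gaps[OF positive(3)] by metis
    obtain k where k: "strict_mono k" and conv: "blowup_converges X a (r0 \<circ> k)"
      using exists_blowup_converges_subseq[OF assms(1) r0] by metis
    define r where "r = r0 \<circ> k"
    have r: "normalizing r"
      unfolding r_def using r0 k by (rule normalizing_subseq)
    have "e \<notin> blowup_limit X a r"
      using gap0[of _ "k _"] unfolding l_eq
      by (intro gap_direction_not_in_blowup_limit[OF r ne e positive(2) \<delta>]) (auto simp: r_def)
    then have miss: "t *\<^sub>R e \<notin> blowup_limit X a r" if "0 < t" for t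
      using blowup_limit_cone[OF assms(1) r _ assms(4,5), of "t *\<^sub>R e" "1 / t"] conv that
      by (auto simp: r_def)
    have "((\<lambda>\<beta>. right_porosity (radii X a l \<beta>) 0) \<longlongrightarrow> 1) (at_right 0)"
    proof (rule porosity_radii_tendsto_1)
      fix \<epsilon> :: real assume \<epsilon>: "0 < \<epsilon>"
      obtain \<beta> where "0 < \<beta>"
          "\<forall>\<^sub>F n in sequentially. \<forall>\<rho>\<in>radii X a l \<beta>. \<epsilon> * r n \<le> \<rho> \<longrightarrow> r n < \<rho>"
        using empty_annuli_near_missed_ray[OF r conv[folded r_def] e miss \<epsilon>] unfolding l_eq by blast
      then show "\<exists>\<beta>>0. ereal (1 - \<epsilon>) \<le> right_porosity (radii X a l \<beta>) 0"
        using porosity_ge_of_empty_annulus[OF r \<epsilon>] by blast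
    qed
    then show ?thesis ..
  qed
qed

end
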